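(* Let $X=(X_v)_{v\in V}$ be the binary random vector of a discrete determinantal point process on a finite set $V$ with kernel $K$. For any disjoint non-empty subsets $A,B$ of $V$, the random vectors $X_A$ and $X_B$ are independent if and only if $K_{A,B}=0$. In particular, for distinct $i,j\in V$, $X_i$ and $X_j$ are independent if and only if $K_{ij}=0$.
   Context: Let $V$ be a finite set. A (discrete) determinantal point process (DPP) on $V$ with kernel $K$ is a random subset $Y$ of $V$ such that $\mathbb{P}(A\subseteq Y)=\det(K_A)$ for all non-empty $A\subseteq V$, where $K\in\mathbb{R}^{V\times V}$ is a (symmetric) positive definite matrix with all eigenvalues at most $1$, and $K_A$ is the principal submatrix of $K$ with rows and columns indexed by $A$. Equivalently, the DPP is the binary random vector $X=(X_v)_{v\in V}\in\{0,1\}^V$ with $X_v=1$ iff $v\in Y$, so that $P(X_A=1_A)=\det(K_A)$, where $X_A=(X_v)_{v\in A}$ and $1_A$ is the all-ones vector indexed by $A$. $K_{A,B}$ denotes the submatrix of $K$ with rows indexed by $A$ and columns indexed by $B$. *)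

theory Defs
  imports "HOL-Probability.Probability"
begin

text \<open>
  The determinant of the principal submatrix \<open>K\<^sub>A\<close>. The library's \<^const>\<open>det\<close> takes its index set
  from a type, so its defining formula is restated with the index set \<open>A\<close>. The two lemmas below
  relate it to \<^const>\<open>det\<close>; the second one covers every non-empty \<open>A\<close>, for any enumeration of \<open>A\<close>
  by a finite type.
\<close>

definition principal_minor :: "'a::comm_ring_1 ^ 'v ^ 'v \<Rightarrow> 'v::finite set \<Rightarrow> 'a" where
  "principal_minor K A = (\<Sum>p | p permutes A. of_int (sign p) * (\<Prod>i\<in>A. K $ i $ p i))"

lemma principal_minor_UNIV: "principal_minor K UNIV = det K"
  by (simp add: principal_minor_def det_def)

lemma principal_minor_eq_det:
  fixes f :: "'n::finite \<Rightarrow> 'v::finite"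
  assumes f: "bij_betw f UNIV A"
  shows "principal_minor K A = det (\<chi> i j. K $ f i $ f j)"
proof -
  have inj: "inj_on f UNIV" and A: "A = f ` UNIV"
    using f by (auto simp: bij_betw_def)
  have "map_permutation UNIV f = (\<lambda>p x. if x \<in> A then f (p (inv_into UNIV f x)) else x)"
    by (auto simp: map_permutation_def restrict_id_def A fun_eq_iff)
  then have perms: "bij_betw (map_permutation UNIV f) {p. p permutes UNIV} {p. p permutes A}"
    using bij_betw_permutations [OF f] by simp
  have "principal_minor K A =
      (\<Sum>p | p permutes (UNIV :: 'n set). of_int (sign (map_permutation UNIV f p)) *
        (\<Prod>i\<in>A. K $ i $ map_permutation UNIV f p i))"
    unfolding principal_minor_def by (rule sum.reindex_bij_betw [symmetric, OF perms])
  also have "\<dots> = det (\<chi> i j. K $ f i $ f j)"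
    unfolding det_def
  proof (intro sum.cong refl)
    fix p :: "'n \<Rightarrow> 'n" assume "p \<in> {p. p permutes UNIV}"
    then have p: "p permutes UNIV" by simp
    have "sign (map_permutation UNIV f p) = sign p"
      by (rule sign_map_permutation [OF inj p]) simp
    moreover have "(\<Prod>i\<in>A. K $ i $ map_permutation UNIV f p i) = (\<Prod>i\<in>UNIV. K $ f i $ f (p i))"
      unfolding A by (subst prod.reindex [OF inj]) (simp add: map_permutation_apply [OF inj])
    ultimately show "of_int (sign (map_permutation UNIV f p)) *
        (\<Prod>i\<in>A. K $ i $ map_permutation UNIV f p i) =
        of_int (sign p) * (\<Prod>i\<in>UNIV. (\<chi> i j. K $ f i $ f j) $ i $ p i)"
      by simp
  qed
  finally show ?thesis .
qed

definition positive_definite :: "real ^ 'v ^ 'v \<Rightarrow> bool" where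
  "positive_definite K \<longleftrightarrow> transpose K = K \<and> (\<forall>x. x \<noteq> 0 \<longrightarrow> x \<bullet> (K *v x) > 0)"

definition eigenvalue :: "'a::comm_ring_1 ^ 'v ^ 'v \<Rightarrow> 'a \<Rightarrow> bool" where
  "eigenvalue K c \<longleftrightarrow> (\<exists>x. x \<noteq> 0 \<and> K *v x = c *s x)"

definition dpp_kernel :: "real ^ 'v ^ 'v \<Rightarrow> bool" where
  "dpp_kernel K \<longleftrightarrow> positive_definite K \<and> (\<forall>c. eigenvalue K c \<longrightarrow> c \<le> 1)"

text \<open>
  The ground set is the finite type \<open>'v\<close>. The random subset \<open>Y\<close> is measurable with respect to the
  discrete \<open>\<sigma>\<close>-algebra on its power set.
\<close>

definition determinantal_process ::
    "'w measure \<Rightarrow> real ^ 'v ^ 'v \<Rightarrow> ('w \<Rightarrow> 'v::finite set) \<Rightarrow> bool" where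
  "determinantal_process M K Y \<longleftrightarrow>
     prob_space M \<and> Y \<in> measurable M (count_space UNIV) \<and> dpp_kernel K \<and>
     (\<forall>A. A \<noteq> {} \<longrightarrow> measure M {\<omega> \<in> space M. A \<subseteq> Y \<omega>} = principal_minor K A)"

definition incidence :: "('w \<Rightarrow> 'v set) \<Rightarrow> 'v \<Rightarrow> 'w \<Rightarrow> real" where
  "incidence Y v \<omega> = (if v \<in> Y \<omega> then 1 else 0)"

definition subvector :: "('v \<Rightarrow> 'w \<Rightarrow> real) \<Rightarrow> 'v set \<Rightarrow> 'w \<Rightarrow> 'v \<Rightarrow> real" where
  "subvector X A \<omega> = (\<lambda>v\<in>A. X v \<omega>)"

end

theory Submission
  imports Defs
begin

text \<open>
  If \<open>X\<^sub>i\<close> and \<open>X\<^sub>j\<close> are independent, then \<open>K\<^sub>i\<^sub>i K\<^sub>j\<^sub>j - K\<^sub>i\<^sub>j K\<^sub>j\<^sub>i = K\<^sub>i\<^sub>i K\<^sub>j\<^sub>j\<close>, so \<open>K\<^sub>i\<^sub>j\<^sup>2 = 0\<close> by symmetry.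
  Conversely, if \<open>K\<^sub>A\<^sub>,\<^sub>B = 0\<close>, then the principal minors factor over \<open>S \<union> T\<close> for \<open>S \<subseteq> A\<close> and
  \<open>T \<subseteq> B\<close>, which says that the events \<open>S \<subseteq> Y\<close> and \<open>T \<subseteq> Y\<close> are independent. These events form
  \<open>\<pi>\<close>-systems that generate the \<open>\<sigma>\<close>-algebras of \<open>X\<^sub>A\<close> and \<open>X\<^sub>B\<close>.
\<close>

lemma principal_minor_empty [simp]: "principal_minor K {} = 1"
  by (simp add: principal_minor_def)

lemma principal_minor_singleton [simp]: "principal_minor K {i} = K $ i $ i"
  by (simp add: principal_minor_def)

lemma principal_minor_doubleton:
  fixes K :: "'a::comm_ring_1 ^ 'v::finite ^ 'v"
  assumes "i \<noteq> j"
  shows "principal_minor K {i, j} = K $ i $ i * K $ j $ j - K $ i $ j * K $ j $ i"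
proof -
  have perms: "{p. p permutes {i, j}} = {id, Transposition.transpose i j}"
    by (auto simp: permutes_doubleton_iff)
  have "id \<noteq> Transposition.transpose i j"
    using assms by (metis id_apply transpose_apply_first)
  then show ?thesis
    using assms by (simp add: principal_minor_def perms sign_swap_id)
qed

text \<open>The block-triangular determinant rule. A permutation moving some \<open>s\<close> of
  \<open>S\<close> into \<open>T\<close> contributes a vanishing factor to the Leibniz sum. Every
  other one preserves \<open>S\<close>, hence also \<open>T\<close>, and factors uniquely into a
  permutation of \<open>S\<close> and one of \<open>T\<close>.\<close>

lemma principal_minor_Un:
  fixes K :: "'a::comm_ring_1 ^ 'v::finite ^ 'v"
  assumes disj: "S \<inter> T = {}" and zero: "\<And>s t. s \<in> S \<Longrightarrow> t \<in> T \<Longrightarrow> K $ s $ t = 0"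
  shows "principal_minor K (S \<union> T) = principal_minor K S * principal_minor K T"
proof -
  let ?w = "\<lambda>A p. of_int (sign p) * (\<Prod>i\<in>A. K $ i $ p i)"
  let ?block = "{p. p permutes S \<union> T \<and> p ` S \<subseteq> S}"
  have "principal_minor K (S \<union> T) = (\<Sum>p\<in>?block. ?w (S \<union> T) p)"
    unfolding principal_minor_def
  proof (rule sum.mono_neutral_right)
    show "\<forall>p\<in>{p. p permutes S \<union> T} - ?block. ?w (S \<union> T) p = 0"
    proof
      fix p assume p: "p \<in> {p. p permutes S \<union> T} - ?block"
      then obtain s where s: "s \<in> S" "p s \<notin> S" by auto
      moreover have "p s \<in> S \<union> T"
        using p s by (metis (lifting) DiffD1 UnI1 mem_Collect_eq permutes_in_image)
      ultimately have "K $ s $ p s = 0"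
        using zero by blast
      then have "(\<Prod>i\<in>S \<union> T. K $ i $ p i) = 0"
        using s by (intro prod_zero) auto
      then show "?w (S \<union> T) p = 0" by simp
    qed
  qed auto
  also have "\<dots> = (\<Sum>(q, r)\<in>{q. q permutes S} \<times> {r. r permutes T}. ?w S q * ?w T r)"
  \<comment> \<open>\<open>restrict_id p S\<close> agrees with \<open>p\<close> on \<open>S\<close>
    and is the identity elsewhere, so composing the two restrictions recovers
    \<open>p\<close>.\<close>
  proof (rule sum.reindex_bij_witness
      [where i = "\<lambda>(q, r). q \<circ> r" and j = "\<lambda>p. (restrict_id p S, restrict_id p T)"])
    fix p assume p: "p \<in> ?block"
    have inj: "inj_on p A" for A using p by (blast intro: permutes_inj_on)
    \<comment> \<open>An injective self-map of a finite set is onto.\<close>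
    have "p ` S = S"
      using p inj by (intro endo_inj_surj) auto
    then have S: "bij_betw p S S"
      by (intro bij_betw_imageI inj)
    have ST: "bij_betw p (S \<union> T) (S \<union> T)"
      using p permutes_imp_bij by blast
    have "p ` T = p ` ((S \<union> T) - S)" using disj by (intro arg_cong[of _ _ "image p"]) auto
    also have "\<dots> = (S \<union> T) - S"
      using S ST inj[of UNIV] by (simp only: image_set_diff bij_betw_def)
    also have "\<dots> = T" using disj by auto
    finally have T: "bij_betw p T T"
      by (intro bij_betw_imageI inj)
    show "(restrict_id p S, restrict_id p T) \<in> {q. q permutes S} \<times> {r. r permutes T}"
      using S T by (simp add: permutes_restrict_id)
    show comp: "(case (restrict_id p S, restrict_id p T) of (q, r) \<Rightarrow> q \<circ> r) = p"
    proof -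
      have "p x \<notin> S" if "x \<in> T" for x
        using T that disj by (auto simp: bij_betw_def)
      moreover have "p x = x" if "x \<notin> S" "x \<notin> T" for x
        using p that by (auto simp: permutes_def)
      ultimately show ?thesis
        using disj by (auto simp: fun_eq_iff restrict_id_def)
    qed
    have "sign p = sign (restrict_id p S) * sign (restrict_id p T)"
      using comp S T
      by (metis case_prod_conv finite permutes_imp_permutation permutes_restrict_id sign_compose)
    then show "(case (restrict_id p S, restrict_id p T) of (q, r) \<Rightarrow> ?w S q * ?w T r) = ?w (S \<union> T) p"
      using disj by (simp add: prod.union_disjoint mult_ac)
  next
    fix x assume "x \<in> {q. q permutes S} \<times> {r. r permutes T}"
    then obtain q r where x: "x = (q, r)" and q: "q permutes S" and r: "r permutes T" by auto
    \<comment> \<open>Each factor fixes the block of the other pointwise, so restricting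
      \<open>q \<circ> r\<close> to a block returns the corresponding factor.\<close>
    have "r s = s" if "s \<in> S" for s
      using r that disj by (auto simp: permutes_def)
    moreover have "q t = t" if "t \<in> T" for t
      using q that disj by (auto simp: permutes_def)
    ultimately show "(restrict_id (case x of (q, r) \<Rightarrow> q \<circ> r) S,
        restrict_id (case x of (q, r) \<Rightarrow> q \<circ> r) T) = x"
      using permutes_in_image[OF r] permutes_not_in[OF q] permutes_not_in[OF r]
      by (auto simp: x fun_eq_iff restrict_id_def)
    have "q \<circ> r permutes S \<union> T"
      using q r by (intro permutes_compose) (auto intro: permutes_subset)
    moreover have "(q \<circ> r) ` S \<subseteq> S"
      using \<open>\<And>s. s \<in> S \<Longrightarrow> r s = s\<close> permutes_in_image[OF q] by auto
    ultimately show "(case x of (q, r) \<Rightarrow> q \<circ> r) \<in> ?block"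
      by (simp add: x)
  qed
  also have "\<dots> = principal_minor K S * principal_minor K T"
    by (simp add: principal_minor_def sum_product sum.cartesian_product)
  finally show ?thesis .
qed

lemma incidence_measurable:
  assumes "{\<omega> \<in> space N. v \<in> Y \<omega>} \<in> sets N"
  shows "incidence Y v \<in> borel_measurable N"
  unfolding incidence_def using assms by (intro measurable_If) auto

text \<open>\<open>N\<close> is left general because two sigma-algebras on the same space matter
  later: that of \<open>M\<close>, and the smaller one generated by
  \<open>containment A\<close>.\<close>

lemma subvector_incidence_measurable:
  assumes "\<And>v. v \<in> A \<Longrightarrow> {\<omega> \<in> space N. v \<in> Y \<omega>} \<in> sets N"
  shows "subvector (incidence Y) A \<in> measurable N (PiM A (\<lambda>_. borel))"
  unfolding subvector_def using assms by (intro measurable_restrict incidence_measurable)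

text \<open>Evaluation at a coordinate is measurable on the product space, and independence survives
  composition with measurable maps.\<close>

lemma indep_coordinates:
  assumes "prob_space M" "a \<in> A" "b \<in> B"
    and indep: "prob_space.indep_var M (PiM A (\<lambda>_. borel)) (subvector X A)
                                       (PiM B (\<lambda>_. borel)) (subvector X B)"
  shows "prob_space.indep_var M borel (X a) borel (X b)"
proof -
  interpret prob_space M by fact
  have "indep_var borel ((\<lambda>f. f a) \<circ> subvector X A) borel ((\<lambda>f. f b) \<circ> subvector X B)"
    using assms by (intro indep_var_compose[OF indep]) simp_all
  moreover have "(\<lambda>f. f a) \<circ> subvector X A = X a" "(\<lambda>f. f b) \<circ> subvector X B = X b"
    using assms by (auto simp: subvector_def fun_eq_iff)
  ultimately show ?thesis by simp
qed

lemma dpp_kernel_sym: "dpp_kernel K \<Longrightarrow> K $ i $ j = K $ j $ i"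
  unfolding dpp_kernel_def positive_definite_def by (metis transpose_def vec_lambda_beta)

locale determinantal =
  fixes M :: "'w measure" and K :: "real ^ 'v ^ 'v" and Y :: "'w \<Rightarrow> 'v::finite set"
  assumes dpp: "determinantal_process M K Y"
begin

sublocale prob_space M
  using dpp by (simp add: determinantal_process_def)

lemma containment_event: "{\<omega> \<in> space M. P (Y \<omega>)} \<in> events"
proof -
  have "Y -` Collect P \<inter> space M \<in> events"
    using dpp by (intro measurable_sets[of _ _ "count_space UNIV"])
      (auto simp: determinantal_process_def)
  then show ?thesis by (simp add: vimage_def Int_def conj_commute)
qed

text \<open>For \<open>S = {}\<close>, which the definition of the process leaves out, both sides
  equal 1.\<close>

lemma prob_containment: "prob {\<omega> \<in> space M. S \<subseteq> Y \<omega>} = principal_minor K S"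
  using dpp by (cases "S = {}") (auto simp: determinantal_process_def prob_space)

lemma kernel_zero_if_indep:
  assumes "i \<noteq> j" and "indep_var borel (incidence Y i) borel (incidence Y j)"
  shows "K $ i $ j = 0"
proof -
  have "prob ((\<lambda>\<omega>. (incidence Y i \<omega>, incidence Y j \<omega>)) -` ({1} \<times> {1}) \<inter> space M) =
      prob (incidence Y i -` {1} \<inter> space M) * prob (incidence Y j -` {1} \<inter> space M)"
    using assms(2) by (intro indep_varD) auto
  moreover have "(\<lambda>\<omega>. (incidence Y i \<omega>, incidence Y j \<omega>)) -` ({1} \<times> {1}) \<inter> space M =
      {\<omega> \<in> space M. {i, j} \<subseteq> Y \<omega>}"
    by (auto simp: incidence_def split: if_splits)
  \<comment> \<open>Membership is phrased as inclusion of a singleton so that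
    \<open>prob_containment\<close> applies to all three events.\<close>
  moreover have "incidence Y v -` {1} \<inter> space M = {\<omega> \<in> space M. {v} \<subseteq> Y \<omega>}" for v
    by (auto simp: incidence_def split: if_splits)
  ultimately have "principal_minor K {i, j} = principal_minor K {i} * principal_minor K {j}"
    by (simp only: prob_containment)
  then have "K $ i $ j * K $ j $ i = 0"
    using assms(1) by (simp add: principal_minor_doubleton)
  then show ?thesis
    using dpp dpp_kernel_sym[of K i j] by (simp add: determinantal_process_def)
qed

definition containment :: "'v set \<Rightarrow> 'w set set" where
  "containment A = (\<lambda>S. {\<omega> \<in> space M. S \<subseteq> Y \<omega>}) ` Pow A"

text \<open>Intersecting two containment events amounts to taking the union of their index
  sets.\<close>

lemma Int_stable_containment: "Int_stable (containment A)"
proof (rule Int_stableI)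
  fix E F assume "E \<in> containment A" "F \<in> containment A"
  then obtain S T where "S \<subseteq> A" "T \<subseteq> A" and
    "E = {\<omega> \<in> space M. S \<subseteq> Y \<omega>}" "F = {\<omega> \<in> space M. T \<subseteq> Y \<omega>}"
    by (auto simp: containment_def)
  moreover from this have "E \<inter> F = {\<omega> \<in> space M. S \<union> T \<subseteq> Y \<omega>}" by auto
  ultimately show "E \<inter> F \<in> containment A"
    by (simp add: containment_def image_eqI[of _ _ "S \<union> T"])
qed

text \<open>Each event \<open>v \<in> Y \<omega>\<close> with \<open>v \<in> A\<close> is itself a
  generator, so the subvector is already measurable for the sigma-algebra generated by
  \<open>containment A\<close>.\<close>

lemma containment_generates:
  "sigma_sets (space M)
      {subvector (incidence Y) A -` E \<inter> space M | E. E \<in> sets (PiM A (\<lambda>_. borel))}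
    \<subseteq> sigma_sets (space M) (containment A)"
proof -
  let ?N = "sigma (space M) (containment A)"
  have sub: "containment A \<subseteq> Pow (space M)" by (auto simp: containment_def)
  have "{\<omega> \<in> space ?N. v \<in> Y \<omega>} \<in> sets ?N" if "v \<in> A" for v
  proof -
    have "{\<omega> \<in> space M. {v} \<subseteq> Y \<omega>} \<in> containment A"
      unfolding containment_def using that by blast
    then show ?thesis using sub by (simp add: sigma_sets.Basic)
  qed
  then have meas: "subvector (incidence Y) A \<in> measurable ?N (PiM A (\<lambda>_. borel))"
    by (rule subvector_incidence_measurable)
  show ?thesis
  proof (rule sigma_sets_mono, clarify)
    fix E :: "('v \<Rightarrow> real) set" assume "E \<in> sets (PiM A (\<lambda>_. borel))"
    from measurable_sets[OF meas this]
    show "subvector (incidence Y) A -` E \<inter> space M \<in> sigma_sets (space M) (containment A)"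
      using sub by simp
  qed
qed

lemma indep_if_kernel_zero:
  assumes disj: "A \<inter> B = {}" and zero: "\<forall>a\<in>A. \<forall>b\<in>B. K $ a $ b = 0"
  shows "indep_var (PiM A (\<lambda>_. borel)) (subvector (incidence Y) A)
                   (PiM B (\<lambda>_. borel)) (subvector (incidence Y) B)"
proof -
  have "indep_set (containment A) (containment B)"
    unfolding indep_sets2_eq
  proof (intro conjI ballI)
    show "containment A \<subseteq> events" "containment B \<subseteq> events"
      by (auto simp: containment_def intro: containment_event)
    fix E F assume "E \<in> containment A" "F \<in> containment B"
    then obtain S T where ST: "S \<subseteq> A" "T \<subseteq> B" and
      EF: "E = {\<omega> \<in> space M. S \<subseteq> Y \<omega>}" "F = {\<omega> \<in> space M. T \<subseteq> Y \<omega>}"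
      by (auto simp: containment_def)
    have "E \<inter> F = {\<omega> \<in> space M. S \<union> T \<subseteq> Y \<omega>}" using EF by auto
    \<comment> \<open>The vanishing of \<open>K\<close> on \<open>A\<close> times \<open>B\<close>
      passes to the smaller block \<open>S\<close> times \<open>T\<close>.\<close>
    moreover have "principal_minor K (S \<union> T) = principal_minor K S * principal_minor K T"
      using ST disj zero by (intro principal_minor_Un) blast+
    ultimately show "prob (E \<inter> F) = prob E * prob F"
      by (simp only: EF prob_containment)
  qed
  then have "indep_set (sigma_sets (space M) (containment A)) (sigma_sets (space M) (containment B))"
    by (intro indep_set_sigma_sets Int_stable_containment)
  \<comment> \<open>Independence of two families is inherited by subfamilies.\<close>
  then have "indep_set
      (sigma_sets (space M)
        {subvector (incidence Y) A -` E \<inter> space M | E. E \<in> sets (PiM A (\<lambda>_. borel))})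
      (sigma_sets (space M)
        {subvector (incidence Y) B -` E \<inter> space M | E. E \<in> sets (PiM B (\<lambda>_. borel))})"
    using containment_generates[of A] containment_generates[of B]
    unfolding indep_sets2_eq by blast
  then show ?thesis
    unfolding indep_var_eq
    using subvector_incidence_measurable[of _ M Y] containment_event by blast
qed

end

theorem theorem2:
  fixes M :: "'w measure" and K :: "real ^ 'v ^ 'v" and Y :: "'w \<Rightarrow> 'v::finite set"
    and X :: "'v \<Rightarrow> 'w \<Rightarrow> real"
  assumes dpp: "determinantal_process M K Y"
    and X: "X = incidence Y"
  shows "(\<forall>A B. A \<noteq> {} \<longrightarrow> B \<noteq> {} \<longrightarrow> A \<inter> B = {} \<longrightarrow>
           (prob_space.indep_var M (PiM A (\<lambda>_. borel)) (subvector X A)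
                                   (PiM B (\<lambda>_. borel)) (subvector X B)
            \<longleftrightarrow> (\<forall>a\<in>A. \<forall>b\<in>B. K $ a $ b = 0))) \<and>
         (\<forall>i j. i \<noteq> j \<longrightarrow>
           (prob_space.indep_var M borel (X i) borel (X j) \<longleftrightarrow> K $ i $ j = 0))"
proof -
  interpret determinantal M K Y
    by unfold_locales (rule dpp)
  note coords = indep_coordinates[OF prob_space_axioms]
  show ?thesis
    unfolding X
  proof (intro conjI allI impI iffI ballI)
    fix A B :: "'v set" and a b
    assume "A \<inter> B = {}" "a \<in> A" "b \<in> B"
      and "indep_var (PiM A (\<lambda>_. borel)) (subvector (incidence Y) A)
                     (PiM B (\<lambda>_. borel)) (subvector (incidence Y) B)"
    \<comment> \<open>Disjointness of \<open>A\<close> and \<open>B\<close> makes \<open>a\<close>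
      and \<open>b\<close> distinct, which reduces the claim to a single pair.\<close>
    then show "K $ a $ b = 0"
      by (intro kernel_zero_if_indep coords[of a A b B]) auto
  next
    fix A B :: "'v set"
    assume "A \<inter> B = {}" "\<forall>a\<in>A. \<forall>b\<in>B. K $ a $ b = 0"
    then show "indep_var (PiM A (\<lambda>_. borel)) (subvector (incidence Y) A)
                         (PiM B (\<lambda>_. borel)) (subvector (incidence Y) B)"
      by (rule indep_if_kernel_zero)
  next
    fix i j :: 'v
    assume "i \<noteq> j" "indep_var borel (incidence Y i) borel (incidence Y j)"
    then show "K $ i $ j = 0"
      by (rule kernel_zero_if_indep)
  next
    fix i j :: 'v
    assume "i \<noteq> j" "K $ i $ j = 0"
    \<comment> \<open>The vector statement for the singletons \<open>{i}\<close> and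
      \<open>{j}\<close> is projected to its only coordinates.\<close>
    then show "indep_var borel (incidence Y i) borel (incidence Y j)"
      by (intro coords[of i "{i}" j "{j}"] indep_if_kernel_zero) simp_all
  qed
qed

end
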